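(* Let $\Omega\subset\mathbb{R}^2$ be a bounded Lipschitz domain and let $\gamma\in\mathcal{M}(\Omega)$ be a positive finite measure. Then for every $u\in L^1(\Omega)$, $$\mathrm{TV}(u)-\gamma(\Omega)\;\leq\;\mathrm{TV}_{pwL}^{\gamma}(u)\;\leq\;\mathrm{TV}(u).$$
   Context: $\mathcal{M}(\Omega)$ denotes the space of finite signed (scalar-valued) Borel measures on $\Omega$, and $\mathfrak{M}(\Omega,\mathbb{R}^2)$ denotes the space of finite $\mathbb{R}^2$-valued Radon measures on $\Omega$. A measure $\mu\in\mathcal{M}(\Omega)$ is positive if $\mu(E)\ge 0$ for every (Borel) $E\subseteq\Omega$; for $\mu_1,\mu_2\in\mathcal{M}(\Omega)$, $\mu_1\leq\mu_2$ means that $\mu_2-\mu_1$ is positive. For $g\in\mathfrak{M}(\Omega,\mathbb{R}^2)$ the variation measure $|g|$ is defined by $$|g|(E)=\sup\Big\{\sum_{i=1}^\infty\|g(E_i)\|_2 \;\Big|\; E=\bigcup_{i\in\mathbb{N}}E_i,\ E_i \text{ pairwise disjoint (Borel)}\Big\},$$ and the Radon norm is $\|g\|_{\mathfrak{M}}=|g|(\Omega)$. For $u\in L^1(\Omega)$, $Du$ denotes the weak (distributional) gradient of $u$. If $Du-g$ is not a finite Radon measure (i.e. $u\notin BV(\Omega)$), then $\|Du-g\|_{\mathfrak{M}}$ is understood to be $+\infty$. The total variation is $\mathrm{TV}(u)=\|Du\|_{\mathfrak{M}}\in[0,+\infty]$. For a finite positive measure $\gamma\in\mathcal{M}(\Omega)$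 and $u\in L^1(\Omega)$ the functional $\mathrm{TV}_{pwL}^\gamma$ is defined by $$\mathrm{TV}_{pwL}^{\gamma}(u):=\inf\big\{\|Du-g\|_{\mathfrak{M}} : g\in\mathfrak{M}(\Omega,\mathbb{R}^2),\ |g|\leq\gamma\big\}\in[0,+\infty].$$ *)

theory Defs
  imports "HOL-Analysis.Analysis"
begin

section \<open>Bounded Lipschitz domains in the plane\<close>

text \<open>
  Near each boundary point \<open>p\<close> the set is the strict epigraph of a Lipschitz function in the
  coordinates given by some orthonormal basis \<open>a\<close>, \<open>b\<close>. Inside the ball the frontier is then
  the graph of that function, and the complement of the closure lies on its other side.
\<close>

definition lipschitz_boundary :: "(real^2) set \<Rightarrow> bool" where
  "lipschitz_boundary \<Omega> \<longleftrightarrow>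
    (\<forall>p\<in>frontier \<Omega>. \<exists>r>0. \<exists>a b L. \<exists>\<psi>::real \<Rightarrow> real.
       norm a = 1 \<and> norm b = 1 \<and> a \<bullet> b = 0 \<and> L-lipschitz_on UNIV \<psi> \<and>
       \<Omega> \<inter> ball p r = {x \<in> ball p r. \<psi> ((x - p) \<bullet> a) < (x - p) \<bullet> b})"

definition bounded_lipschitz_domain :: "(real^2) set \<Rightarrow> bool" where
  "bounded_lipschitz_domain \<Omega> \<longleftrightarrow>
    open \<Omega> \<and> connected \<Omega> \<and> \<Omega> \<noteq> {} \<and> bounded \<Omega> \<and> lipschitz_boundary \<Omega>"


section \<open>Finite vector-valued Borel measures\<close>

text \<open>
  Vector measures on \<open>\<Omega>\<close> are set functions of which only the values on the Borel subsets of
  \<open>\<Omega>\<close> matter. They are finite because their values are; on an open subset of a Euclidean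
  space every finite Borel measure is Radon, so regularity is not a further condition.
\<close>

definition vector_measures ::
  "'a::topological_space set \<Rightarrow> ('a set \<Rightarrow> 'b::real_normed_vector) set" where
  "vector_measures \<Omega> = {\<mu>. \<mu> {} = 0 \<and>
    (\<forall>A::nat \<Rightarrow> 'a set. range A \<subseteq> sets (restrict_space borel \<Omega>) \<longrightarrow> disjoint_family A \<longrightarrow>
       (\<lambda>i. \<mu> (A i)) sums \<mu> (\<Union>i. A i))}"

definition variation ::
  "('a::topological_space set \<Rightarrow> 'b::real_normed_vector) \<Rightarrow> 'a set \<Rightarrow> ennreal" where
  "variation \<mu> E =
    (SUP A\<in>{A::nat \<Rightarrow> 'a set. range A \<subseteq> sets borel \<and> disjoint_family A \<and> (\<Union>i. A i) = E}.
       \<Sum>i. ennreal (norm (\<mu> (A i))))"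

definition radon_norm ::
  "'a::topological_space set \<Rightarrow> ('a set \<Rightarrow> 'b::real_normed_vector) \<Rightarrow> ennreal" where
  "radon_norm \<Omega> \<mu> = variation \<mu> \<Omega>"

text \<open>
  The positive part of a signed measure in its Jordan decomposition,
  \<open>\<nu>\<^sup>+(E) = sup {\<nu>(F) | F \<subseteq> E}\<close>. Since \<^const>\<open>ennreal\<close> sends negative numbers to \<open>0\<close>,
  such \<open>F\<close> contribute only \<open>0 = \<nu>({})\<close>. The negative part of \<open>\<nu>\<close> is the positive part of \<open>-\<nu>\<close>.
\<close>

definition jordan_pos :: "'a::topological_space set \<Rightarrow> ('a set \<Rightarrow> real) \<Rightarrow> 'a measure" where
  "jordan_pos \<Omega> \<nu> = measure_of \<Omega> (sets (restrict_space borel \<Omega>))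
    (\<lambda>E. SUP F\<in>{F \<in> sets borel. F \<subseteq> E}. ennreal (\<nu> F))"

definition signed_integral ::
  "'a::topological_space set \<Rightarrow> ('a set \<Rightarrow> real) \<Rightarrow> ('a \<Rightarrow> real) \<Rightarrow> real" where
  "signed_integral \<Omega> \<nu> f =
    (\<integral>x. f x \<partial>jordan_pos \<Omega> \<nu>) - (\<integral>x. f x \<partial>jordan_pos \<Omega> (\<lambda>E. - \<nu> E))"


section \<open>Distributional gradients and total variation\<close>

primrec C_k :: "nat \<Rightarrow> ('a::real_normed_vector \<Rightarrow> 'b::real_normed_vector) \<Rightarrow> bool" where
  "C_k 0 f \<longleftrightarrow> continuous_on UNIV f"
| "C_k (Suc k) f \<longleftrightarrow>
    (\<forall>x. f differentiable (at x)) \<and> (\<forall>v. C_k k (\<lambda>x. frechet_derivative f (at x) v))"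

definition test_functions :: "'a::real_normed_vector set \<Rightarrow> ('a \<Rightarrow> real) set" where
  "test_functions \<Omega> =
    {\<phi>. (\<forall>k. C_k k \<phi>) \<and> (\<exists>K. compact K \<and> K \<subseteq> \<Omega> \<and> (\<forall>x. x \<notin> K \<longrightarrow> \<phi> x = 0))}"

definition is_weak_gradient ::
  "(real^2) set \<Rightarrow> (real^2 \<Rightarrow> real) \<Rightarrow> ((real^2) set \<Rightarrow> real^2) \<Rightarrow> bool" where
  "is_weak_gradient \<Omega> u \<mu> \<longleftrightarrow>
    (\<forall>\<phi>\<in>test_functions \<Omega>. \<forall>i.
       (LINT x:\<Omega>|lebesgue. u x * frechet_derivative \<phi> (at x) (axis i 1)) =
       - signed_integral \<Omega> (\<lambda>E. \<mu> E $ i) \<phi>)"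

definition L1 :: "(real^2) set \<Rightarrow> (real^2 \<Rightarrow> real) set" where
  "L1 \<Omega> = {u. set_integrable lebesgue \<Omega> u}"

definition BV :: "(real^2) set \<Rightarrow> (real^2 \<Rightarrow> real) set" where
  "BV \<Omega> = {u \<in> L1 \<Omega>. \<exists>\<mu>\<in>vector_measures \<Omega>. is_weak_gradient \<Omega> u \<mu>}"

text \<open>
  For \<open>u\<close> in \<^term>\<open>BV \<Omega>\<close> the measure representing the distributional gradient is unique on the
  Borel subsets of \<open>\<Omega>\<close>; the choice only concerns the irrelevant values on other sets.
\<close>

definition grad_measure :: "(real^2) set \<Rightarrow> (real^2 \<Rightarrow> real) \<Rightarrow> (real^2) set \<Rightarrow> real^2" where
  "grad_measure \<Omega> u = (SOME \<mu>. \<mu> \<in> vector_measures \<Omega> \<and> is_weak_gradient \<Omega> u \<mu>)"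

definition grad_minus_norm ::
  "(real^2) set \<Rightarrow> (real^2 \<Rightarrow> real) \<Rightarrow> ((real^2) set \<Rightarrow> real^2) \<Rightarrow> ennreal" where
  "grad_minus_norm \<Omega> u g =
    (if u \<in> BV \<Omega> then radon_norm \<Omega> (\<lambda>E. grad_measure \<Omega> u E - g E) else \<infinity>)"

definition TV :: "(real^2) set \<Rightarrow> (real^2 \<Rightarrow> real) \<Rightarrow> ennreal" where
  "TV \<Omega> u = (if u \<in> BV \<Omega> then radon_norm \<Omega> (grad_measure \<Omega> u) else \<infinity>)"

definition TV_pwL :: "(real^2) set \<Rightarrow> (real^2) measure \<Rightarrow> (real^2 \<Rightarrow> real) \<Rightarrow> ennreal" where
  "TV_pwL \<Omega> \<gamma> u =
    (INF g\<in>{g \<in> vector_measures \<Omega>.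
        \<forall>E\<in>sets (restrict_space borel \<Omega>). variation g E \<le> emeasure \<gamma> E}.
       grad_minus_norm \<Omega> u g)"

end

theory Submission
  imports Defs
begin

text \<open>Both bounds come from comparing competitors in the infimum. For the upper bound the
  competitor \<open>g = 0\<close> is admissible, since its variation vanishes, and it gives exactly
  \<open>TV \<Omega> u\<close>. For the lower bound write \<open>Du = (Du - g) + g\<close>:
  subadditivity of the variation (\<open>variation_add_le\<close>) bounds
  \<open>TV \<Omega> u\<close> by the norm of \<open>Du - g\<close> plus the mass
  \<open>|g|(\<Omega>)\<close>, and admissibility bounds that mass by
  \<open>\<gamma>(\<Omega>)\<close> for all \<open>g\<close> at once. So the estimate survives the
  infimum over \<open>g\<close>.\<close>

lemma variation_zero: "variation (\<lambda>_. 0) E = 0"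
  by (auto simp: variation_def bot_ennreal intro!: antisym SUP_least)

text \<open>On each partition the triangle inequality holds term by term, and one and the same
  partition is a competitor in both suprema on the right.\<close>

lemma variation_add_le:
  "variation (\<lambda>E. \<mu> E + \<nu> E) E \<le> variation \<mu> E + variation \<nu> E"
  unfolding variation_def
proof (rule SUP_least)
  fix A :: "nat \<Rightarrow> 'a set"
  assume A: "A \<in> {A. range A \<subseteq> sets borel \<and> disjoint_family A \<and> (\<Union>i. A i) = E}"
  have "(\<Sum>i. ennreal (norm (\<mu> (A i) + \<nu> (A i))))
      \<le> (\<Sum>i. ennreal (norm (\<mu> (A i))) + ennreal (norm (\<nu> (A i))))"
    by (intro suminf_le summableI) (simp add: norm_triangle_ineq flip: ennreal_plus)
  also have "\<dots> = (\<Sum>i. ennreal (norm (\<mu> (A i)))) + (\<Sum>i. ennreal (norm (\<nu> (A i))))"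
    by (simp add: suminf_add)
  also have "\<dots> \<le>
      (SUP A\<in>{A. range A \<subseteq> sets borel \<and> disjoint_family A \<and> (\<Union>i. A i) = E}.
         \<Sum>i. ennreal (norm (\<mu> (A i)))) +
      (SUP A\<in>{A. range A \<subseteq> sets borel \<and> disjoint_family A \<and> (\<Union>i. A i) = E}.
         \<Sum>i. ennreal (norm (\<nu> (A i))))"
    by (intro add_mono SUP_upper A)
  finally show "(\<Sum>i. ennreal (norm (\<mu> (A i) + \<nu> (A i)))) \<le> \<dots>" .
qed

lemma TV_pwL_le_TV: "TV_pwL \<Omega> \<gamma> u \<le> TV \<Omega> u"
proof -
  have "TV_pwL \<Omega> \<gamma> u \<le> grad_minus_norm \<Omega> u (\<lambda>_. 0)"
    unfolding TV_pwL_def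
    by (intro INF_lower) (simp add: vector_measures_def variation_zero)
  also have "\<dots> = TV \<Omega> u"
    by (simp add: grad_minus_norm_def TV_def)
  finally show ?thesis .
qed

text \<open>For \<open>u\<close> in \<open>BV \<Omega>\<close> this is subadditivity for the
  splitting \<open>Du = (Du - g) + g\<close>; otherwise both sides are infinite.\<close>

lemma TV_le_grad_minus_norm: "TV \<Omega> u \<le> grad_minus_norm \<Omega> u g + variation g \<Omega>"
  using variation_add_le[of "\<lambda>E. grad_measure \<Omega> u E - g E" g \<Omega>]
  by (simp add: TV_def grad_minus_norm_def radon_norm_def)

lemma TV_le_TV_pwL:
  assumes "finite_measure \<gamma>" and "\<Omega> \<in> sets (restrict_space borel \<Omega>)"
  shows "TV \<Omega> u \<le> TV_pwL \<Omega> \<gamma> u + ennreal (measure \<gamma> \<Omega>)"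
proof -
  have fin: "emeasure \<gamma> \<Omega> = ennreal (measure \<gamma> \<Omega>)"
    by (rule finite_measure.emeasure_eq_measure[OF assms(1)])
  \<comment> \<open>With the mass on the left, the claim is that a constant is a lower bound of the
    infimum. Moving it across is legitimate because it is finite, although \<open>ennreal\<close>
    subtraction truncates at zero.\<close>
  have "TV \<Omega> u - ennreal (measure \<gamma> \<Omega>) \<le> TV_pwL \<Omega> \<gamma> u"
    unfolding TV_pwL_def
  proof (rule INF_greatest)
    fix g :: "(real^2) set \<Rightarrow> real^2"
    assume "g \<in> {g \<in> vector_measures \<Omega>.
      \<forall>E\<in>sets (restrict_space borel \<Omega>). variation g E \<le> emeasure \<gamma> E}"
    \<comment> \<open>The constraint on \<open>g\<close> is used only on the whole domain,
      \<open>E = \<Omega>\<close>.\<close>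
    then have "variation g \<Omega> \<le> ennreal (measure \<gamma> \<Omega>)"
      using assms(2) fin by auto
    then have "TV \<Omega> u \<le> ennreal (measure \<gamma> \<Omega>) + grad_minus_norm \<Omega> u g"
      using TV_le_grad_minus_norm[of \<Omega> u g]
      by (metis add.commute add_left_mono order_trans)
    then show "TV \<Omega> u - ennreal (measure \<gamma> \<Omega>) \<le> grad_minus_norm \<Omega> u g"
      by (simp add: ennreal_minus_le_iff)
  qed
  then show ?thesis
    by (simp add: ennreal_minus_le_iff add.commute)
qed

theorem theorem2:
  fixes \<Omega> :: "(real^2) set" and \<gamma> :: "(real^2) measure" and u :: "real^2 \<Rightarrow> real"
  assumes "bounded_lipschitz_domain \<Omega>"
    and "finite_measure \<gamma>" and "sets \<gamma> = sets (restrict_space borel \<Omega>)"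
    and "u \<in> L1 \<Omega>"
  shows "enn2ereal (TV \<Omega> u) - ereal (measure \<gamma> \<Omega>) \<le> enn2ereal (TV_pwL \<Omega> \<gamma> u)
    \<and> TV_pwL \<Omega> \<gamma> u \<le> TV \<Omega> u"
proof
  have "\<Omega> \<in> sets (restrict_space borel \<Omega>)"
    using sets.top[of "restrict_space borel \<Omega>"] by (simp add: space_restrict_space)
  then have "TV \<Omega> u \<le> TV_pwL \<Omega> \<gamma> u + ennreal (measure \<gamma> \<Omega>)"
    by (rule TV_le_TV_pwL[OF assms(2)])
  \<comment> \<open>The difference in the theorem may be negative, so the additive estimate is
    carried to \<open>ereal\<close> before the finite mass is subtracted there.\<close>
  then have "enn2ereal (TV \<Omega> u) \<le> enn2ereal (TV_pwL \<Omega> \<gamma> u) + ereal (measure \<gamma> \<Omega>)"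
    by (simp add: less_eq_ennreal.rep_eq plus_ennreal.rep_eq enn2ereal_ennreal)
  then show "enn2ereal (TV \<Omega> u) - ereal (measure \<gamma> \<Omega>) \<le> enn2ereal (TV_pwL \<Omega> \<gamma> u)"
    by (simp add: ereal_minus_le)
  show "TV_pwL \<Omega> \<gamma> u \<le> TV \<Omega> u"
    by (rule TV_pwL_le_TV)
qed

end
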